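(* Let $d\ge2$ and $H\in(0,1/2]$, and let $X=(X_t)_{t\in\mathbb S^{d-1}}$ be a spherical fractional Brownian motion with Hurst parameter $H$ (jointly measurable version). Then $$|\sigma^{d-1}|^{-1}\int_{\mathbb S^{d-1}}\mathbf 1\{X_s>0\}\,\sigma^{d-1}(ds)$$ is uniformly distributed on $(0,1)$, where $|\sigma^{d-1}|=\sigma^{d-1}(\mathbb S^{d-1})=2\pi^{d/2}/\Gamma(d/2)$.
   Context: $\mathbb S^{d-1}=\{x\in\mathbb R^d:\|x\|=1\}$ is the unit sphere with surface measure $\sigma^{d-1}$ and geodesic distance $d(s,t)$. A spherical fractional Brownian motion with Hurst parameter $H\in(0,1/2]$ is a centred real Gaussian process $(X_t)_{t\in\mathbb S^{d-1}}$ such that $X_O=0$ a.s. for some fixed point $O\in\mathbb S^{d-1}$ and $\mathbb E[(X_s-X_t)^2]=d(s,t)^{2H}$ for all $s,t\in\mathbb S^{d-1}$. *)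

theory Defs
  imports "HOL-Probability.Probability"
begin

definition geodesic_dist :: "'a::real_inner \<Rightarrow> 'a \<Rightarrow> real" where
  "geodesic_dist s t = arccos (s \<bullet> t)"

text \<open>Surface measure on the unit sphere of a Euclidean space (cone-measure construction:
  sigma(A) = d * lambda_d of the cone over A of radius 1).\<close>
definition sphere_measure :: "'a::euclidean_space measure" where
  "sphere_measure = measure_of (sphere 0 1) (sets (restrict_space borel (sphere (0::'a) 1)))
     (\<lambda>A. of_nat DIM('a) * emeasure lborel {r *\<^sub>R x | r x. 0 < r \<and> r \<le> 1 \<and> x \<in> A})"

definition centred_gaussian_rv :: "'w measure \<Rightarrow> ('w \<Rightarrow> real) \<Rightarrow> bool" where
  "centred_gaussian_rv M Y \<longleftrightarrow> Y \<in> borel_measurable M \<and>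
     ((\<exists>\<sigma>>0. distributed M lborel Y (normal_density 0 \<sigma>)) \<or> (AE \<omega> in M. Y \<omega> = 0))"

definition centred_gaussian_process :: "'w measure \<Rightarrow> 't set \<Rightarrow> ('t \<Rightarrow> 'w \<Rightarrow> real) \<Rightarrow> bool" where
  "centred_gaussian_process M T X \<longleftrightarrow>
     (\<forall>S c. finite S \<longrightarrow> S \<subseteq> T \<longrightarrow> centred_gaussian_rv M (\<lambda>\<omega>. \<Sum>t\<in>S. c t * X t \<omega>))"

definition spherical_fBm :: "'w measure \<Rightarrow> real \<Rightarrow> ('a::euclidean_space \<Rightarrow> 'w \<Rightarrow> real) \<Rightarrow> bool" where
  "spherical_fBm M H X \<longleftrightarrow>
     centred_gaussian_process M (sphere 0 1) X \<and>
     (\<exists>p0\<in>sphere 0 1. AE \<omega> in M. X p0 \<omega> = 0) \<and>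
     (\<forall>s\<in>sphere 0 1. \<forall>t\<in>sphere 0 1.
        prob_space.expectation M (\<lambda>\<omega>. (X s \<omega> - X t \<omega>)\<^sup>2) = geodesic_dist s t powr (2 * H))"

end

theory Submission
  imports Defs
begin

text \<open>Let \<open>\<sigma>\<close> be the normalised surface measure and \<open>U\<^sub>t\<close> the share of points \<open>s\<close> with
  \<open>X\<^sub>s > X\<^sub>t\<close>. The \<open>k\<close>-th moment of \<open>U\<^sub>t\<close> is the integral over \<open>(s\<^sub>1, \<dots>, s\<^sub>k)\<close> of the probability
  that all \<open>X\<close> at \<open>s\<^sub>i\<close> exceed \<open>X\<^sub>t\<close>. This probability depends only on the mutual distances of
  \<open>s\<^sub>1, \<dots>, s\<^sub>k, t\<close>, so by rotation invariance of \<open>\<sigma>\<close> all \<open>U\<^sub>t\<close> have the same moments, hence the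
  same law. On the other hand almost every path takes each value on a null set only, so
  for fixed \<open>\<omega>\<close> and \<open>\<sigma>\<close>-random \<open>t\<close> the probability integral transform makes \<open>U\<^sub>t(\<omega>)\<close>
  uniform. Averaging over \<open>t\<close>, the common law is uniform; and \<open>X\<close> vanishes at \<open>O\<close>.\<close>

subsection \<open>Characteristic functions determine orthant probabilities\<close>

context prob_space begin

text \<open>Reweighting by \<open>W / m\<close> and pushing forward along \<open>Y\<close> gives a
  genuine probability law. Weighted transforms thus become characteristic functions, within reach of
  Levy's uniqueness theorem.\<close>

lemma weighted_law:
  fixes W Y :: "'a \<Rightarrow> real"
  assumes [measurable]: "W \<in> borel_measurable M" "Y \<in> borel_measurable M"
    and W: "\<And>\<omega>. 0 \<le> W \<omega>" "\<And>\<omega>. W \<omega> \<le> C"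
    and m: "expectation W = m" "0 < m"
  defines "N \<equiv> distr (density M (\<lambda>\<omega>. ennreal (W \<omega> / m))) borel Y"
  shows "real_distribution N"
    and "char N a = (CLINT \<omega>|M. of_real (W \<omega>) * iexp (a * Y \<omega>)) / of_real m"
    and "A \<in> sets borel \<Longrightarrow> measure N A = (LINT \<omega>|M. W \<omega> * indicator A (Y \<omega>)) / m"
proof -
  have int: "integrable M W"
    by (rule integrable_const_bound[where B = C]) (use W in auto)
  have "(\<integral>\<^sup>+\<omega>. ennreal (W \<omega> / m) \<partial>M) = ennreal (expectation (\<lambda>\<omega>. W \<omega> / m))"
    by (rule nn_integral_eq_integral) (use int W m in auto)
  also have "\<dots> = 1" using m by simp
  finally have "prob_space (density M (\<lambda>\<omega>. ennreal (W \<omega> / m)))"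
    by (intro prob_spaceI) (simp add: emeasure_density cong: nn_integral_cong)
  then interpret D: prob_space "density M (\<lambda>\<omega>. ennreal (W \<omega> / m))" .
  show "real_distribution N"
    unfolding N_def by (rule D.real_distribution_distr) simp
  show "char N a = (CLINT \<omega>|M. of_real (W \<omega>) * iexp (a * Y \<omega>)) / of_real m"
    unfolding char_def N_def
    by (subst integral_distr) (use W m in \<open>auto simp: integral_density scaleR_conv_of_real\<close>)
  show "measure N A = (LINT \<omega>|M. W \<omega> * indicator A (Y \<omega>)) / m" if [measurable]: "A \<in> sets borel"
  proof -
    interpret N: real_distribution N by fact
    have "measure N A = (LINT x|N. indicator A x)" by simp
    also have "\<dots> = (LINT \<omega>|M. W \<omega> / m * indicator A (Y \<omega>))"
      unfolding N_def by (subst integral_distr) (use W m in \<open>auto simp: integral_density\<close>)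
    finally show ?thesis by simp
  qed
qed

text \<open>Frequency \<open>a = 0\<close> shows that both weights have the same mass. If it is
  positive, the normalised weighted laws share a characteristic function and so coincide; if it is
  zero, both weights vanish almost everywhere.\<close>

lemma weighted_halfline_eqI:
  fixes V W Y Z :: "'a \<Rightarrow> real"
  assumes meas[measurable]: "V \<in> borel_measurable M" "W \<in> borel_measurable M"
      "Y \<in> borel_measurable M" "Z \<in> borel_measurable M"
    and V: "\<And>\<omega>. 0 \<le> V \<omega>" "\<And>\<omega>. V \<omega> \<le> C"
    and W: "\<And>\<omega>. 0 \<le> W \<omega>" "\<And>\<omega>. W \<omega> \<le> C"
    and eq: "\<And>a. (CLINT \<omega>|M. of_real (V \<omega>) * iexp (a * Y \<omega>)) = (CLINT \<omega>|M. of_real (W \<omega>) * iexp (a * Z \<omega>))"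
  shows "(LINT \<omega>|M. V \<omega> * indicator {0<..} (Y \<omega>)) = (LINT \<omega>|M. W \<omega> * indicator {0<..} (Z \<omega>))"
proof -
  have int: "integrable M V" "integrable M W"
    by (rule integrable_const_bound[where B = C]; use V W in auto)+
  have "complex_of_real (expectation V) = complex_of_real (expectation W)"
    using eq[of 0] by simp
  then have mass: "expectation W = expectation V" by simp
  show ?thesis
  proof (cases "expectation V = 0")
    case True
    then have "AE \<omega> in M. V \<omega> = 0" "AE \<omega> in M. W \<omega> = 0"
      using integral_nonneg_eq_0_iff_AE[OF int(1)] integral_nonneg_eq_0_iff_AE[OF int(2)] V W mass by auto
    then have "(LINT \<omega>|M. V \<omega> * indicator {0<..} (Y \<omega>)) = 0"
      "(LINT \<omega>|M. W \<omega> * indicator {0<..} (Z \<omega>)) = 0"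
      by (auto intro!: integral_eq_zero_AE)
    then show ?thesis by simp
  next
    case False
    then have m: "0 < expectation V"
      using V by (simp add: integral_nonneg order.not_eq_order_implies_strict)
    note v = weighted_law[OF meas(1,3) V refl m] and w = weighted_law[OF meas(2,4) W mass m]
    have "distr (density M (\<lambda>\<omega>. ennreal (V \<omega> / expectation V))) borel Y
        = distr (density M (\<lambda>\<omega>. ennreal (W \<omega> / expectation V))) borel Z"
      by (rule Levy_uniqueness[OF v(1) w(1)]) (rule ext, simp only: v(2) w(2) eq)
    with v(3)[of "{0<..}"] w(3)[of "{0<..}"] m show ?thesis by simp
  qed
qed

text \<open>A multivariate uniqueness statement from the one-dimensional one: coordinates pass one
  at a time from the exponential into the indicator product. The exponential factor stays, with
  \<open>c\<close> arbitrary, because each step changes the frequencies used in the induction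
  hypothesis.\<close>

lemma orthant_weight_eqI:
  fixes Y Z :: "'i \<Rightarrow> 'a \<Rightarrow> real"
  assumes "finite I"
    and meas: "\<And>i. i \<in> I \<Longrightarrow> Y i \<in> borel_measurable M" "\<And>i. i \<in> I \<Longrightarrow> Z i \<in> borel_measurable M"
    and char_eq: "\<And>c. (CLINT \<omega>|M. iexp (\<Sum>i\<in>I. c i * Y i \<omega>)) = (CLINT \<omega>|M. iexp (\<Sum>i\<in>I. c i * Z i \<omega>))"
    and "A \<subseteq> I"
  shows "(CLINT \<omega>|M. of_real (\<Prod>i\<in>A. indicator {0<..} (Y i \<omega>)) * iexp (\<Sum>i\<in>I. c i * Y i \<omega>))
       = (CLINT \<omega>|M. of_real (\<Prod>i\<in>A. indicator {0<..} (Z i \<omega>)) * iexp (\<Sum>i\<in>I. c i * Z i \<omega>))"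
  using finite_subset[OF \<open>A \<subseteq> I\<close> \<open>finite I\<close>] \<open>A \<subseteq> I\<close>
proof (induction A arbitrary: c rule: finite_induct)
  case empty
  from char_eq[of c] show ?case by simp
next
  case (insert j A)
  then have A: "A \<subseteq> I" "j \<in> I" "finite A" "j \<notin> A" by auto
  define P where "P = (\<lambda>(U :: 'i \<Rightarrow> 'a \<Rightarrow> real) \<omega>. \<Prod>i\<in>A. indicator {0<..} (U i \<omega>) :: real)"
  define L where "L = (\<lambda>(U :: 'i \<Rightarrow> 'a \<Rightarrow> real) d \<omega>. \<Sum>i\<in>I. d i * U i \<omega>)"
  have P: "0 \<le> P U \<omega>" "P U \<omega> \<le> 1" for U \<omega>
    by (auto simp: P_def prod_nonneg intro!: prod_le_1)
  have PLm: "P U \<in> borel_measurable M" "L U d \<in> borel_measurable M" "U j \<in> borel_measurable M"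
    if "U \<in> {Y, Z}" for U d
    unfolding P_def L_def using that A(1,2) meas by (auto intro!: borel_measurable_sum borel_measurable_prod)
  have IH: "(CLINT \<omega>|M. of_real (P Y \<omega>) * iexp (L Y d \<omega>)) = (CLINT \<omega>|M. of_real (P Z \<omega>) * iexp (L Z d \<omega>))" for d
    using insert.IH[OF A(1)] by (simp add: P_def L_def)
  \<comment> \<open>Rescaling \<open>c\<close> by \<open>s\<close> and adding frequency
    \<open>a\<close> at \<open>j\<close> is again a linear combination over \<open>I\<close>, so the
    induction hypothesis covers it.\<close>
  have L_upd: "L U (\<lambda>i. s * c i + (if i = j then a else 0)) \<omega> = s * L U c \<omega> + a * U j \<omega>" for U s a \<omega>
    using A(2) \<open>finite I\<close>
    by (simp add: L_def distrib_right sum.distrib sum_distrib_left mult.assoc if_distrib[where f = "\<lambda>x. x * _"]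
      sum.delta cong: if_cong)
  have int: "integrable M (\<lambda>\<omega>. of_real (P U \<omega>) * iexp (f \<omega>))" if "U \<in> {Y, Z}" and [measurable]: "f \<in> borel_measurable M" for U f
  proof -
    note [measurable] = PLm[OF that(1)]
    show ?thesis
      by (rule integrable_const_bound[where B = 1]) (use P in \<open>auto simp: norm_mult\<close>)
  qed
  \<comment> \<open>\<open>\<beta> = 1, -\<i>\<close> give the nonnegative weights \<open>1 + cos\<close> and \<open>1 + sin\<close>; \<open>\<beta> = 0\<close> gives \<open>1\<close>.\<close>
  define K where "K = (\<lambda>U \<beta> \<omega>. P U \<omega> * (1 + Re (\<beta> * iexp (L U c \<omega>))))"
  \<comment> \<open>\<open>norm \<beta> \<le> 1\<close> keeps the weight between 0 and 2, as the
    half-line comparison demands.\<close>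
  have K: "(LINT \<omega>|M. K Y \<beta> \<omega> * indicator {0<..} (Y j \<omega>)) = (LINT \<omega>|M. K Z \<beta> \<omega> * indicator {0<..} (Z j \<omega>))"
    if \<beta>: "norm \<beta> \<le> 1" for \<beta>
  proof (rule weighted_halfline_eqI[where C = 2])
    have Re: "\<bar>Re (\<beta> * iexp x)\<bar> \<le> 1" for x
      using abs_Re_le_cmod[of "\<beta> * iexp x"] \<beta> by (simp add: norm_mult)
    have 0: "0 \<le> K U \<beta> \<omega>" "K U \<beta> \<omega> \<le> 2" for U \<omega>
    proof -
      show "0 \<le> K U \<beta> \<omega>" using P[of U \<omega>] Re[of "L U c \<omega>"] by (simp add: K_def abs_le_iff)
      have "K U \<beta> \<omega> \<le> 1 * 2" unfolding K_def
        using P[of U \<omega>] Re[of "L U c \<omega>"] by (intro mult_mono) (auto simp: abs_le_iff)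
      then show "K U \<beta> \<omega> \<le> 2" by simp
    qed
    show "0 \<le> K Y \<beta> \<omega>" "K Y \<beta> \<omega> \<le> 2" "0 \<le> K Z \<beta> \<omega>" "K Z \<beta> \<omega> \<le> 2" for \<omega> by (rule 0)+
    have Km: "K U \<beta> \<in> borel_measurable M" if "U \<in> {Y, Z}" for U
    proof -
      note [measurable] = PLm[OF that]
      show ?thesis unfolding K_def by measurable
    qed
    show "K Y \<beta> \<in> borel_measurable M" "K Z \<beta> \<in> borel_measurable M"
      "Y j \<in> borel_measurable M" "Z j \<in> borel_measurable M"
      using Km PLm by auto
    fix a
    \<comment> \<open>Since \<open>Re z = (z + cnj z) / 2\<close>, the weighted transform splits
      into three transforms with frequencies \<open>0\<close>, \<open>c\<close> and
      \<open>-c\<close>, each shifted by \<open>a\<close> at \<open>j\<close>.\<close>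
    have split: "(CLINT \<omega>|M. of_real (K U \<beta> \<omega>) * iexp (a * U j \<omega>))
        = (CLINT \<omega>|M. of_real (P U \<omega>) * iexp (L U (\<lambda>i. 0 * c i + (if i = j then a else 0)) \<omega>))
          + \<beta> / 2 * (CLINT \<omega>|M. of_real (P U \<omega>) * iexp (L U (\<lambda>i. 1 * c i + (if i = j then a else 0)) \<omega>))
          + cnj \<beta> / 2 * (CLINT \<omega>|M. of_real (P U \<omega>) * iexp (L U (\<lambda>i. -1 * c i + (if i = j then a else 0)) \<omega>))"
      if U: "U \<in> {Y, Z}" for U
    proof -
      have re: "complex_of_real (Re z) = (z + cnj z) / 2" for z by (simp add: complex_add_cnj)
      have e: "of_real (K U \<beta> \<omega>) * iexp (a * U j \<omega>)
         = of_real (P U \<omega>) * iexp (0 * L U c \<omega> + a * U j \<omega>)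
          + \<beta> / 2 * (of_real (P U \<omega>) * iexp (1 * L U c \<omega> + a * U j \<omega>))
          + cnj \<beta> / 2 * (of_real (P U \<omega>) * iexp (-1 * L U c \<omega> + a * U j \<omega>))" for \<omega>
        unfolding K_def of_real_mult of_real_add re
        by (simp add: exp_cnj ring_distribs exp_add exp_diff exp_minus field_simps)
      have i: "integrable M (\<lambda>\<omega>. of_real (P U \<omega>) * iexp (s * L U c \<omega> + a * U j \<omega>))" for s
        using PLm[OF U] by (intro int[OF U] borel_measurable_add borel_measurable_times) auto
      have lin: "(CLINT \<omega>|M. f \<omega> + p * g \<omega> + q * h \<omega>) = (CLINT \<omega>|M. f \<omega>) + p * (CLINT \<omega>|M. g \<omega>) + q * (CLINT \<omega>|M. h \<omega>)"
        if "integrable M f" "integrable M g" "integrable M h" for f g h :: "'a \<Rightarrow> complex" and p q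
        using that by simp
      show ?thesis
        unfolding e L_upd by (rule lin) (rule i)+
    qed
    show "(CLINT \<omega>|M. of_real (K Y \<beta> \<omega>) * iexp (a * Y j \<omega>)) = (CLINT \<omega>|M. of_real (K Z \<beta> \<omega>) * iexp (a * Z j \<omega>))"
      by (simp only: split IH insertI1 insertI2)
  qed
  \<comment> \<open>Subtracting the weight for \<open>\<beta> = 0\<close> leaves cos for
    \<open>\<beta> = 1\<close> and sin for \<open>\<beta> = -\<i>\<close>, that is, the real and
    imaginary parts of the exponential.\<close>
  have fin: "(CLINT \<omega>|M. of_real (\<Prod>i\<in>insert j A. indicator {0<..} (U i \<omega>)) * iexp (\<Sum>i\<in>I. c i * U i \<omega>))
     = Complex ((LINT \<omega>|M. K U 1 \<omega> * indicator {0<..} (U j \<omega>)) - (LINT \<omega>|M. K U 0 \<omega> * indicator {0<..} (U j \<omega>)))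
        ((LINT \<omega>|M. K U (-\<i>) \<omega> * indicator {0<..} (U j \<omega>)) - (LINT \<omega>|M. K U 0 \<omega> * indicator {0<..} (U j \<omega>)))"
    if U: "U \<in> {Y, Z}" for U
  proof -
    note [measurable] = PLm[OF U]
    have int': "integrable M (\<lambda>\<omega>. K U \<beta> \<omega> * indicator {0<..} (U j \<omega>))" for \<beta>
    proof (rule integrable_const_bound[where B = "1 * (1 + norm \<beta>)"])
      show "AE \<omega> in M. norm (K U \<beta> \<omega> * indicator {0<..} (U j \<omega>)) \<le> 1 * (1 + norm \<beta>)"
      proof (rule AE_I2)
        fix \<omega>
        have "\<bar>1 + Re (\<beta> * iexp (L U c \<omega>))\<bar> \<le> 1 + norm \<beta>"
          using abs_Re_le_cmod[of "\<beta> * iexp (L U c \<omega>)"] by (auto simp: norm_mult abs_le_iff)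
        then have "\<bar>P U \<omega>\<bar> * \<bar>1 + Re (\<beta> * iexp (L U c \<omega>))\<bar> \<le> 1 * (1 + norm \<beta>)"
          by (intro mult_mono) (use P[of U \<omega>] in auto)
        then show "norm (K U \<beta> \<omega> * indicator {0<..} (U j \<omega>)) \<le> 1 * (1 + norm \<beta>)"
          by (auto simp: K_def abs_mult indicator_def)
      qed
    qed (simp add: K_def)
    have e: "of_real (\<Prod>i\<in>insert j A. indicator {0<..} (U i \<omega>)) * iexp (\<Sum>i\<in>I. c i * U i \<omega>)
      = of_real (K U 1 \<omega> * indicator {0<..} (U j \<omega>) - K U 0 \<omega> * indicator {0<..} (U j \<omega>))
       + \<i> * of_real (K U (-\<i>) \<omega> * indicator {0<..} (U j \<omega>) - K U 0 \<omega> * indicator {0<..} (U j \<omega>))" for \<omega>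
      using A(3,4)
      by (simp add: K_def P_def L_def complex_eq_iff Re_exp Im_exp algebra_simps)
    have lin: "(CLINT \<omega>|M. of_real (f \<omega>) + \<i> * of_real (g \<omega>)) = Complex (expectation f) (expectation g)"
      if fg: "integrable M f" "integrable M g" for f g :: "'a \<Rightarrow> real"
    proof -
      have "integrable M (\<lambda>\<omega>. complex_of_real (f \<omega>))" "integrable M (\<lambda>\<omega>. complex_of_real (g \<omega>))"
        using fg by auto
      then show ?thesis by (simp add: integral_complex_of_real complex_eq_iff)
    qed
    show ?thesis
      unfolding e by (subst lin) (simp_all add: int' Bochner_Integration.integral_diff)
  qed
  show ?case by (simp only: fin insertI1 insertI2 K norm_one norm_zero norm_minus_cancel norm_ii order_refl zero_le_one)
qed

lemma orthant_prob_eqI: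
  fixes Y Z :: "'i \<Rightarrow> 'a \<Rightarrow> real"
  assumes "finite I"
    and [measurable]: "\<And>i. i \<in> I \<Longrightarrow> Y i \<in> borel_measurable M" "\<And>i. i \<in> I \<Longrightarrow> Z i \<in> borel_measurable M"
    and char_eq: "\<And>c. (CLINT \<omega>|M. iexp (\<Sum>i\<in>I. c i * Y i \<omega>)) = (CLINT \<omega>|M. iexp (\<Sum>i\<in>I. c i * Z i \<omega>))"
  shows "(LINT \<omega>|M. (\<Prod>i\<in>I. indicator {0<..} (Y i \<omega>))) = (LINT \<omega>|M. (\<Prod>i\<in>I. indicator {0<..} (Z i \<omega>)) :: real)"
proof -
  have "complex_of_real (LINT \<omega>|M. (\<Prod>i\<in>I. indicator {0<..} (Y i \<omega>))) = complex_of_real (LINT \<omega>|M. (\<Prod>i\<in>I. indicator {0<..} (Z i \<omega>)))"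
    \<comment> \<open>With zero frequencies the exponential factor is 1.\<close>
    using orthant_weight_eqI[OF assms order_refl, of "\<lambda>_. 0"]
    by (simp del: of_real_prod add: integral_complex_of_real)
  then show ?thesis by (simp only: of_real_eq_iff)
qed

end

subsection \<open>Gaussian increments\<close>

text \<open>The second moment alone fixes the characteristic function. The degenerate case fits the
  same formula with second moment 0; otherwise dividing by \<sigma> reduces to the standard normal
  law.\<close>

lemma (in prob_space) centred_gaussian_rv_char:
  assumes "centred_gaussian_rv M Y"
  shows "integrable M (\<lambda>\<omega>. (Y \<omega>)\<^sup>2)"
    and "(CLINT \<omega>|M. iexp (Y \<omega>)) = of_real (exp (- expectation (\<lambda>\<omega>. (Y \<omega>)\<^sup>2) / 2))"
proof -
  have Y[measurable]: "Y \<in> borel_measurable M"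
    using assms by (simp add: centred_gaussian_rv_def)
  consider \<sigma> where "\<sigma> > 0" "distributed M lborel Y (normal_density 0 \<sigma>)" | "AE \<omega> in M. Y \<omega> = 0"
    using assms unfolding centred_gaussian_rv_def by blast
  then have "integrable M (\<lambda>\<omega>. (Y \<omega>)\<^sup>2)
     \<and> (CLINT \<omega>|M. iexp (Y \<omega>)) = of_real (exp (- expectation (\<lambda>\<omega>. (Y \<omega>)\<^sup>2) / 2))"
  proof cases
    case 1
    have int: "integrable M (\<lambda>\<omega>. (Y \<omega>)\<^sup>2)"
      using distributed_integrable[OF 1(2), of "\<lambda>x. x\<^sup>2"] integrable_normal_moment[OF 1(1), of 0 2] by auto
    have var: "expectation (\<lambda>\<omega>. (Y \<omega>)\<^sup>2) = \<sigma>\<^sup>2"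
      using normal_distributed_variance[OF 1] normal_distributed_expectation[OF 1] by simp
    have "distributed M lborel (\<lambda>\<omega>. Y \<omega> / \<sigma>) std_normal_density"
      using normal_standard_normal_convert[of \<sigma> Y 0] 1 by simp
    then have d: "distr M lborel (\<lambda>\<omega>. Y \<omega> / \<sigma>) = std_normal_distribution"
      by (simp add: distributed_def)
    have "(CLINT \<omega>|M. iexp (Y \<omega>)) = (CLINT \<omega>|M. iexp (\<sigma> * (Y \<omega> / \<sigma>)))"
      using 1(1) by simp
    also have "\<dots> = (CLINT x|distr M lborel (\<lambda>\<omega>. Y \<omega> / \<sigma>). iexp (\<sigma> * x))"
      by (subst integral_distr) auto
    also have "\<dots> = of_real (exp (- (\<sigma>\<^sup>2) / 2))"
      using fun_cong[OF char_std_normal_distribution, of \<sigma>] by (simp only: d char_def)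
    finally show ?thesis using int var by simp
  next
    case 2
    have "integrable M (\<lambda>\<omega>. (Y \<omega>)\<^sup>2) \<longleftrightarrow> integrable M (\<lambda>\<omega>. 0::real)"
      by (rule integrable_cong_AE) (use 2 in auto)
    moreover have "expectation (\<lambda>\<omega>. (Y \<omega>)\<^sup>2) = 0"
      by (rule integral_eq_zero_AE) (use 2 in auto)
    moreover have "(CLINT \<omega>|M. iexp (Y \<omega>)) = (CLINT \<omega>|M. 1)"
      by (rule integral_cong_AE) (use 2 in auto)
    ultimately show ?thesis by (simp add: prob_space)
  qed
  then show "integrable M (\<lambda>\<omega>. (Y \<omega>)\<^sup>2)"
    "(CLINT \<omega>|M. iexp (Y \<omega>)) = of_real (exp (- expectation (\<lambda>\<omega>. (Y \<omega>)\<^sup>2) / 2))" by auto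
qed

text \<open>A nonzero second moment excludes the degenerate alternative, and a law with a density
  has no atom at 0.\<close>

lemma (in prob_space) centred_gaussian_rv_nonzero:
  assumes "centred_gaussian_rv M Y" "expectation (\<lambda>\<omega>. (Y \<omega>)\<^sup>2) \<noteq> 0"
  shows "AE \<omega> in M. Y \<omega> \<noteq> 0"
proof -
  have Y[measurable]: "Y \<in> borel_measurable M"
    using assms by (simp add: centred_gaussian_rv_def)
  have "\<not> (AE \<omega> in M. Y \<omega> = 0)"
    using assms(2) integral_eq_zero_AE[of "\<lambda>\<omega>. (Y \<omega>)\<^sup>2" M] by auto
  then obtain \<sigma> where "\<sigma> > 0" and d: "distributed M lborel Y (normal_density 0 \<sigma>)"
    using assms(1) unfolding centred_gaussian_rv_def by blast
  have "AE x in lborel. x \<noteq> (0::real)" by (rule AE_lborel_singleton)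
  then have "AE x in density lborel (\<lambda>x. ennreal (normal_density 0 \<sigma> x)). x \<noteq> 0"
    by (subst AE_density) auto
  moreover have "distr M lborel Y = density lborel (\<lambda>x. ennreal (normal_density 0 \<sigma> x))"
    using d by (simp add: distributed_def)
  ultimately have "AE x in distr M lborel Y. x \<noteq> 0"
    by (simp only:)
  then show ?thesis by (subst (asm) AE_distr_iff) auto
qed

text \<open>The process definition sums over sets of points, whereas the sampled points
  \<open>s j\<close> may coincide. Adding the coefficients over each fibre of \<open>s\<close>
  bridges the two.\<close>

lemma centred_gaussian_process_indexed:
  assumes "centred_gaussian_process M T X" "finite J" "s ` J \<subseteq> T"
  shows "centred_gaussian_rv M (\<lambda>\<omega>. \<Sum>j\<in>J. d j * X (s j) \<omega>)"
proof -
  have "(\<Sum>j\<in>J. d j * X (s j) \<omega>) = (\<Sum>t\<in>s ` J. (\<Sum>j\<in>{j\<in>J. s j = t}. d j) * X t \<omega>)" for \<omega>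
    by (subst sum.image_gen[OF assms(2), of _ s]) (auto simp: sum_distrib_right intro!: sum.cong)
  then show ?thesis
    using assms by (simp add: centred_gaussian_process_def)
qed

lemma centred_gaussian_process_diff:
  assumes "centred_gaussian_process M T X" "s \<in> T" "t \<in> T"
  shows "centred_gaussian_rv M (\<lambda>\<omega>. X s \<omega> - X t \<omega>)"
proof -
  have "centred_gaussian_rv M (\<lambda>\<omega>. \<Sum>b\<in>UNIV. (if b then 1 else -1) * X (if b then s else t) \<omega>)"
    by (rule centred_gaussian_process_indexed[OF assms(1)]) (use assms in auto)
  then show ?thesis unfolding UNIV_bool by simp
qed

text \<open>Expanding the squared differences, the pure squares cancel because the coefficients sum
  to 0, and only the cross terms survive. Second moments of such combinations are therefore
  determined by the increments, which is all that the covariance structure prescribes.\<close>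

lemma sum_square_eq_pair_diffs:
  fixes d v :: "'i \<Rightarrow> real"
  assumes "sum d J = 0"
  shows "(\<Sum>j\<in>J. d j * v j)\<^sup>2 = - (\<Sum>i\<in>J. \<Sum>j\<in>J. d i * d j * (v i - v j)\<^sup>2) / 2"
proof -
  have "(\<Sum>i\<in>J. \<Sum>j\<in>J. d i * d j * (v i - v j)\<^sup>2)
      = (\<Sum>i\<in>J. \<Sum>j\<in>J. (d i * (v i)\<^sup>2) * d j + d i * (d j * (v j)\<^sup>2) - 2 * ((d i * v i) * (d j * v j)))"
    by (intro sum.cong refl) (simp add: power2_eq_square algebra_simps)
  also have "\<dots> = - 2 * (\<Sum>j\<in>J. d j * v j)\<^sup>2"
    by (simp add: sum.distrib sum_subtractf power2_eq_square assms
        flip: sum_product sum_distrib_left sum_distrib_right)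
  finally show ?thesis by simp
qed

text \<open>Both combinations are centred Gaussian, and with coefficients of sum 0 their second
  moments are built from increment variances alone.\<close>

lemma (in prob_space) gaussian_increments_char_eq:
  assumes X: "centred_gaussian_process M T X" and J: "finite J" "s ` J \<subseteq> T" "t ` J \<subseteq> T"
    and var: "\<And>i j. i \<in> J \<Longrightarrow> j \<in> J \<Longrightarrow> expectation (\<lambda>\<omega>. (X (s i) \<omega> - X (s j) \<omega>)\<^sup>2) = expectation (\<lambda>\<omega>. (X (t i) \<omega> - X (t j) \<omega>)\<^sup>2)"
    and d: "sum d J = 0"
  shows "(CLINT \<omega>|M. iexp (\<Sum>j\<in>J. d j * X (s j) \<omega>)) = (CLINT \<omega>|M. iexp (\<Sum>j\<in>J. d j * X (t j) \<omega>))"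
proof -
  have second_moment: "expectation (\<lambda>\<omega>. (\<Sum>j\<in>J. d j * X (u j) \<omega>)\<^sup>2)
     = - (\<Sum>i\<in>J. \<Sum>j\<in>J. d i * d j * expectation (\<lambda>\<omega>. (X (u i) \<omega> - X (u j) \<omega>)\<^sup>2)) / 2"
    if u: "u ` J \<subseteq> T" for u
  proof -
    have int: "integrable M (\<lambda>\<omega>. (X (u i) \<omega> - X (u j) \<omega>)\<^sup>2)" if "i \<in> J" "j \<in> J" for i j
    proof -
      have "u i \<in> T" "u j \<in> T" using that u by auto
      from centred_gaussian_rv_char(1)[OF centred_gaussian_process_diff[OF X this]] show ?thesis .
    qed
    show ?thesis
      unfolding sum_square_eq_pair_diffs[OF d] using int by simp
  qed
  show ?thesis
    unfolding centred_gaussian_rv_char(2)[OF centred_gaussian_process_indexed[OF X J(1,2)]]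
      centred_gaussian_rv_char(2)[OF centred_gaussian_process_indexed[OF X J(1,3)]]
      second_moment[OF J(2)] second_moment[OF J(3)]
    using var by simp
qed

lemma (in prob_space) gaussian_increments_orthant_eq:
  fixes s t :: "nat \<Rightarrow> 't"
  assumes X: "centred_gaussian_process M T X" and J: "s ` {..k} \<subseteq> T" "t ` {..k} \<subseteq> T"
    and var: "\<And>i j. i \<le> k \<Longrightarrow> j \<le> k \<Longrightarrow> expectation (\<lambda>\<omega>. (X (s i) \<omega> - X (s j) \<omega>)\<^sup>2) = expectation (\<lambda>\<omega>. (X (t i) \<omega> - X (t j) \<omega>)\<^sup>2)"
  shows "(LINT \<omega>|M. (\<Prod>i<k. indicator {0<..} (X (s i) \<omega> - X (s k) \<omega>)))
       = (LINT \<omega>|M. (\<Prod>i<k. indicator {0<..} (X (t i) \<omega> - X (t k) \<omega>)) :: real)"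
proof (rule orthant_prob_eqI)
  have meas: "X t \<in> borel_measurable M" if "t \<in> T" for t
    using centred_gaussian_process_indexed[OF X, of "{()}" "\<lambda>_. t" "\<lambda>_. 1"] that
    by (auto simp: centred_gaussian_rv_def)
  show "(\<lambda>\<omega>. X (s i) \<omega> - X (s k) \<omega>) \<in> borel_measurable M"
    "(\<lambda>\<omega>. X (t i) \<omega> - X (t k) \<omega>) \<in> borel_measurable M" if "i \<in> {..<k}" for i
    using that J by (auto intro!: borel_measurable_diff meas)
  fix c :: "nat \<Rightarrow> real"
  \<comment> \<open>The reference index \<open>k\<close> receives minus the sum of the other
    coefficients, so a combination of increments becomes one of values with total coefficient
    0.\<close>
  define d where "d i = (if i < k then c i else - (\<Sum>i<k. c i))" for i
  have d: "(\<Sum>i<k. c i * (X (u i) \<omega> - X (u k) \<omega>)) = (\<Sum>i\<le>k. d i * X (u i) \<omega>)" for u \<omega>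
    by (simp add: d_def lessThan_Suc_atMost[symmetric] right_diff_distrib sum_subtractf sum_distrib_right)
  have "sum d {..k} = 0"
    by (simp add: d_def lessThan_Suc_atMost[symmetric])
  then show "(CLINT \<omega>|M. iexp (\<Sum>i<k. c i * (X (s i) \<omega> - X (s k) \<omega>))) = (CLINT \<omega>|M. iexp (\<Sum>i<k. c i * (X (t i) \<omega> - X (t k) \<omega>)))"
    unfolding d by (intro gaussian_increments_char_eq[OF X _ J]) (auto intro: var)
qed simp

subsection \<open>Surface measure of the sphere\<close>

text \<open>Polar decomposition \<open>y = norm y *\<^sub>R sgn y\<close> on the punctured ball; in
  this form the cone measure is visibly a pushforward.\<close>

lemma cone_eq_vimage_sgn:
  fixes A :: "'a::euclidean_space set"
  assumes "A \<subseteq> sphere 0 1"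
  shows "{r *\<^sub>R x | r x. 0 < r \<and> r \<le> 1 \<and> x \<in> A} = sgn -` A \<inter> (cball 0 1 - {0})"
proof (intro set_eqI iffI)
  fix y assume "y \<in> {r *\<^sub>R x | r x. 0 < r \<and> r \<le> 1 \<and> x \<in> A}"
  then obtain r x where "y = r *\<^sub>R x" "0 < r" "r \<le> 1" "x \<in> A" by blast
  moreover have "norm x = 1" using assms \<open>x \<in> A\<close> by auto
  moreover from this have "x \<noteq> 0" by auto
  ultimately show "y \<in> sgn -` A \<inter> (cball 0 1 - {0})"
    by (simp add: sgn_div_norm)
next
  fix y assume "y \<in> sgn -` A \<inter> (cball 0 1 - {0})"
  then show "y \<in> {r *\<^sub>R x | r x. 0 < r \<and> r \<le> 1 \<and> x \<in> A}"
    by (intro CollectI exI[of _ "norm y"] exI[of _ "sgn y"]) (auto simp: sgn_div_norm)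
qed

lemma sgn_measurable_sphere:
  "sgn \<in> restrict_space lborel (cball 0 1 - {0}) \<rightarrow>\<^sub>M restrict_space borel (sphere (0::'a::euclidean_space) 1)"
proof (rule measurable_restrict_space2)
  have [measurable]: "(sgn :: 'a \<Rightarrow> 'a) \<in> borel_measurable borel"
    unfolding sgn_div_norm[abs_def] by measurable
  show "sgn \<in> restrict_space lborel (cball 0 1 - {0}) \<rightarrow>\<^sub>M (borel :: 'a measure)"
    by (rule measurable_restrict_space1) simp
qed (auto simp: space_restrict_space norm_sgn)

text \<open>\<open>measure_of\<close> keeps a set function only if it is a measure. The pushforward
  of Lebesgue measure under \<open>sgn\<close> is one and has the same values, which settles
  countable additivity.\<close>

lemma sphere_measure_eq_distr:
  "(sphere_measure :: 'a::euclidean_space measure) = scale_measure (of_nat DIM('a))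
     (distr (restrict_space lborel (cball 0 1 - {0})) (restrict_space borel (sphere 0 1)) sgn)" (is "_ = ?N")
proof -
  have sp: "space ?N = sphere 0 1" and st: "sets ?N = sets (restrict_space borel (sphere 0 1))"
    by (auto simp: space_scale_measure space_restrict_space)
  have "?N = measure_of (sphere 0 1) (sets (restrict_space borel (sphere (0::'a) 1))) (emeasure ?N)"
    using measure_of_of_measure[of ?N] by (simp only: sp st)
  also have "\<dots> = sphere_measure"
    unfolding sphere_measure_def
  proof (rule measure_of_eq)
    show sub: "sets (restrict_space borel (sphere (0::'a) 1)) \<subseteq> Pow (sphere 0 1)"
      using sets.sets_into_space[of _ "restrict_space borel (sphere (0::'a) 1)"] by (auto simp: space_restrict_space)
    fix A assume "A \<in> sigma_sets (sphere 0 1) (sets (restrict_space borel (sphere (0::'a) 1)))"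
    then have A: "A \<in> sets (restrict_space borel (sphere (0::'a) 1))"
      using sets.sigma_sets_eq[of "restrict_space borel (sphere (0::'a) 1)"] by (simp add: space_restrict_space)
    show "emeasure ?N A = of_nat DIM('a) * emeasure lborel {r *\<^sub>R x | r x. 0 < r \<and> r \<le> 1 \<and> x \<in> A}"
      using A sub
      by (subst cone_eq_vimage_sgn)
        (auto simp: emeasure_distr[OF sgn_measurable_sphere] emeasure_restrict_space space_restrict_space)
  qed
  finally show ?thesis by simp
qed

lemma space_sphere_measure [simp]: "space sphere_measure = sphere 0 1"
  by (simp add: sphere_measure_eq_distr space_scale_measure space_restrict_space)

lemma sets_sphere_measure [measurable_cong, simp]:
  "sets sphere_measure = sets (restrict_space borel (sphere 0 1))"
  by (simp add: sphere_measure_eq_distr)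

lemma emeasure_sphere_measure:
  fixes A :: "'a::euclidean_space set"
  assumes "A \<in> sets (restrict_space borel (sphere 0 1))"
  shows "emeasure sphere_measure A = of_nat DIM('a) * emeasure lborel (sgn -` A \<inter> (cball 0 1 - {0}))"
  using assms
  by (simp add: sphere_measure_eq_distr emeasure_distr[OF sgn_measurable_sphere] emeasure_restrict_space space_restrict_space)

lemma emeasure_sphere_measure_sphere:
  "emeasure sphere_measure (sphere (0::'a::euclidean_space) 1) = ennreal (DIM('a) * unit_ball_vol DIM('a))"
proof -
  have "sphere 0 1 \<in> sets (restrict_space borel (sphere (0::'a) 1))"
    by (metis sets.top space_sphere_measure sets_sphere_measure)
  moreover have "sgn -` sphere 0 1 \<inter> (cball 0 1 - {0::'a}) = cball 0 1 - {0}"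
    by (auto simp: norm_sgn)
  moreover have "emeasure lborel (cball 0 1 - {0::'a}) = emeasure lborel (cball (0::'a) 1)"
    by (subst emeasure_Diff) auto
  ultimately show ?thesis
    by (simp add: emeasure_sphere_measure emeasure_cball ennreal_mult ennreal_of_nat_eq_real_of_nat)
qed

lemma measure_sphere_measure_sphere:
  "measure sphere_measure (sphere (0::'a::euclidean_space) 1) = 2 * pi powr (DIM('a) / 2) / Gamma (DIM('a) / 2)"
proof -
  have "measure sphere_measure (sphere (0::'a) 1) = DIM('a) * unit_ball_vol DIM('a)"
    unfolding measure_def emeasure_sphere_measure_sphere by simp
  \<comment> \<open>The ball volume contains \<open>Gamma (d/2 + 1)\<close>; the functional equation
    turns the factor \<open>d\<close> into 2.\<close>
  moreover have "Gamma (real DIM('a) / 2 + 1) = real DIM('a) / 2 * Gamma (real DIM('a) / 2)"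
  proof (rule Gamma_plus1, rule notI)
    assume "real DIM('a) / 2 \<in> \<int>\<^sub>\<le>\<^sub>0"
    then obtain n where "real DIM('a) / 2 = of_int n" "n \<le> 0" by (elim nonpos_Ints_cases)
    then have "real DIM('a) / 2 \<le> 0" by simp
    then show False using DIM_positive[where 'a = 'a] by simp
  qed
  ultimately show ?thesis
    by (simp add: unit_ball_vol_def)
qed

lemma finite_measure_sphere_measure: "finite_measure sphere_measure"
  by (rule finite_measureI) (simp add: emeasure_sphere_measure_sphere)

text \<open>The cone over a point lies on a line, which is Lebesgue-null in dimension at least
  2.\<close>

lemma emeasure_sphere_measure_singleton:
  fixes x :: "'a::euclidean_space"
  assumes "DIM('a) \<ge> 2" "norm x = 1"
  shows "emeasure sphere_measure {x} = 0"
proof -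
  have sets: "{x} \<in> sets (restrict_space borel (sphere 0 1))"
    unfolding sets_restrict_space by (rule image_eqI[where x = "{x}"]) (use assms in auto)
  have "(sgn :: 'a \<Rightarrow> 'a) \<in> borel_measurable borel"
    unfolding sgn_div_norm[abs_def] by measurable
  then have b: "sgn -` {x} \<inter> (cball 0 1 - {0}) \<in> sets lborel"
    using measurable_sets[of sgn borel borel "{x}"] by auto
  have "sgn -` {x} \<inter> (cball 0 1 - {0}) \<subseteq> span {x}"
  proof
    fix y assume "y \<in> sgn -` {x} \<inter> (cball 0 1 - {0})"
    then have "y = norm y *\<^sub>R x" by (auto simp: sgn_div_norm)
    then show "y \<in> span {x}" by (metis span_base span_mul singletonI)
  qed
  moreover have "negligible (span {x})"
  proof (rule negligible_lowdim)
    have "dim (span {x}) \<le> card {x}" by (simp add: dim_le_card')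
    then show "dim (span {x}) < DIM('a)" using assms by simp
  qed
  ultimately have "negligible (sgn -` {x} \<inter> (cball 0 1 - {0}))"
    by (rule negligible_subset[rotated])
  then have "emeasure lborel (sgn -` {x} \<inter> (cball 0 1 - {0})) = 0"
    using b by (simp add: negligible_iff_null_sets null_sets_def)
  then show ?thesis by (simp add: emeasure_sphere_measure[OF sets])
qed

section \<open>Rotation invariance of Lebesgue and surface measure\<close>

lemma nn_integral_lborel_translate:
  fixes g :: "'a::euclidean_space \<Rightarrow> ennreal"
  assumes [measurable]: "g \<in> borel_measurable borel"
  shows "(\<integral>\<^sup>+x. g (c + x) \<partial>lborel) = (\<integral>\<^sup>+x. g x \<partial>lborel)"
proof -
  have "(\<integral>\<^sup>+x. g x \<partial>distr lborel borel ((+) c)) = (\<integral>\<^sup>+x. g (c + x) \<partial>lborel)"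
    by (rule nn_integral_distr) auto
  then show ?thesis by (simp add: lborel_distr_plus)
qed

lemma nn_integral_lborel_reflect:
  fixes g :: "'a::euclidean_space \<Rightarrow> ennreal"
  assumes [measurable]: "g \<in> borel_measurable borel"
  shows "(\<integral>\<^sup>+x. g (c - x) \<partial>lborel) = (\<integral>\<^sup>+x. g x \<partial>lborel)"
proof -
  have "(lborel :: 'a measure) = distr lborel borel (\<lambda>x. c + (-1) *\<^sub>R x)"
    by (subst lborel_affine[of "-1" c]) (auto simp: density_1 one_ennreal_def[symmetric])
  then have "(\<integral>\<^sup>+x. g x \<partial>lborel) = (\<integral>\<^sup>+x. g x \<partial>distr lborel borel (\<lambda>x. c + (-1) *\<^sub>R x))"
    by (rule arg_cong)
  also have "\<dots> = (\<integral>\<^sup>+x. g (c - x) \<partial>lborel)"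
    by (subst nn_integral_distr) auto
  finally show ?thesis by simp
qed

text \<open>The library has this only for \<open>real ^ 'n\<close> with a well-ordered index type. Integrate
  \<open>1\<^sub>A(x) 1\<^sub>B(x + f z)\<close> over both variables, \<open>B\<close> the unit ball: translation
  invariance alone gives \<open>|A| |B|\<close> in one order of integration and \<open>|B| |f\<^sup>-\<^sup>1 A|\<close>
  in the other.\<close>
lemma emeasure_lborel_vimage_orthogonal:
  fixes f :: "'a::euclidean_space \<Rightarrow> 'a"
  assumes f: "orthogonal_transformation f" and A[measurable]: "A \<in> sets borel"
  shows "emeasure lborel (f -` A) = emeasure lborel A"
proof -
  let ?B = "ball (0::'a) 1"
  have [measurable]: "?B \<in> sets borel" by simp
  have lin: "linear f" using f by (rule orthogonal_transformation_linear)
  have [measurable]: "f \<in> borel_measurable borel"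
    using lin by (intro borel_measurable_continuous_onI linear_continuous_on) (simp add: linear_conv_bounded_linear)
  obtain g where g: "\<And>x. f (g x) = x"
    using orthogonal_transformation_surj[OF f] by (metis surjD)
  have inner: "(\<integral>\<^sup>+z. indicator C (x + f z) \<partial>lborel) = emeasure lborel (f -` C)"
    "(\<integral>\<^sup>+z. indicator C (x - f z) \<partial>lborel) = emeasure lborel (f -` C)"
    if [measurable]: "C \<in> sets borel" for C x
  proof -
    have [measurable]: "f -` C \<in> sets borel"
      using measurable_sets[of f borel borel C] by simp
    have "(\<integral>\<^sup>+z. indicator C (x + f z) \<partial>lborel) = (\<integral>\<^sup>+z. indicator (f -` C) (g x + z) \<partial>lborel)"
      by (rule nn_integral_cong) (simp add: indicator_def linear_add[OF lin] g)
    then show "(\<integral>\<^sup>+z. indicator C (x + f z) \<partial>lborel) = emeasure lborel (f -` C)"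
      by (simp add: nn_integral_lborel_translate)
    have "(\<integral>\<^sup>+z. indicator C (x - f z) \<partial>lborel) = (\<integral>\<^sup>+z. indicator (f -` C) (g x - z) \<partial>lborel)"
      by (rule nn_integral_cong) (simp add: indicator_def linear_diff[OF lin] g)
    then show "(\<integral>\<^sup>+z. indicator C (x - f z) \<partial>lborel) = emeasure lborel (f -` C)"
      by (simp add: nn_integral_lborel_reflect)
  qed
  \<comment> \<open>Only here does orthogonality enter beyond linearity and surjectivity: the ball
    is its own preimage.\<close>
  have "f -` ?B = ?B" by (auto simp: orthogonal_transformation_norm[OF f])
  then have "emeasure lborel A * emeasure lborel ?B
      = (\<integral>\<^sup>+x. indicator A x * (\<integral>\<^sup>+z. indicator ?B (x + f z) \<partial>lborel) \<partial>lborel)"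
    by (simp add: inner nn_integral_multc)
  also have "\<dots> = (\<integral>\<^sup>+x. \<integral>\<^sup>+z. indicator A x * indicator ?B (x + f z) \<partial>lborel \<partial>lborel)"
    by (intro nn_integral_cong nn_integral_cmult[symmetric]) measurable
  also have "\<dots> = (\<integral>\<^sup>+z. \<integral>\<^sup>+x. indicator A x * indicator ?B (x + f z) \<partial>lborel \<partial>lborel)"
    by (rule lborel_pair.Fubini'[symmetric]) measurable
  \<comment> \<open>Translating \<open>x\<close> by \<open>- f z\<close> at fixed \<open>z\<close>
    frees the ball indicator of \<open>z\<close>.\<close>
  also have "\<dots> = (\<integral>\<^sup>+z. \<integral>\<^sup>+x. indicator A (x - f z) * indicator ?B x \<partial>lborel \<partial>lborel)"
  proof (rule nn_integral_cong)
    fix z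
    have "(\<integral>\<^sup>+x. indicator A (- f z + x) * indicator ?B ((- f z + x) + f z) \<partial>lborel) = (\<integral>\<^sup>+x. indicator A x * indicator ?B (x + f z) \<partial>lborel)"
      by (rule nn_integral_lborel_translate) measurable
    then show "(\<integral>\<^sup>+x. indicator A x * indicator ?B (x + f z) \<partial>lborel) = (\<integral>\<^sup>+x. indicator A (x - f z) * indicator ?B x \<partial>lborel)"
      by simp
  qed
  also have "\<dots> = (\<integral>\<^sup>+x. \<integral>\<^sup>+z. indicator A (x - f z) * indicator ?B x \<partial>lborel \<partial>lborel)"
    by (rule lborel_pair.Fubini') measurable
  also have "\<dots> = (\<integral>\<^sup>+x. (\<integral>\<^sup>+z. indicator A (x - f z) \<partial>lborel) * indicator ?B x \<partial>lborel)"
    by (intro nn_integral_cong nn_integral_multc) measurable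
  also have "\<dots> = emeasure lborel (f -` A) * emeasure lborel ?B"
    by (simp add: inner nn_integral_cmult)
  finally have "emeasure lborel ?B * emeasure lborel A = emeasure lborel ?B * emeasure lborel (f -` A)"
    by (simp only: mult.commute)
  moreover have "emeasure lborel ?B \<noteq> 0" "emeasure lborel ?B \<noteq> \<top>"
    using unit_ball_vol_pos[of "real DIM('a)"] by (simp_all add: emeasure_ball del: unit_ball_vol_pos)
  ultimately show ?thesis
    by (simp add: ennreal_mult_cancel_left)
qed

lemma orthogonal_transformation_measurable_sphere:
  fixes f :: "'a::euclidean_space \<Rightarrow> 'a"
  assumes f: "orthogonal_transformation f"
  shows "f \<in> sphere_measure \<rightarrow>\<^sub>M sphere_measure"
proof -
  have "f \<in> borel_measurable borel"
    using orthogonal_transformation_linear[OF f]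
    by (intro borel_measurable_continuous_onI linear_continuous_on) (simp add: linear_conv_bounded_linear)
  then have "f \<in> restrict_space borel (sphere 0 1) \<rightarrow>\<^sub>M restrict_space borel (sphere 0 1)"
    by (intro measurable_restrict_space3) (auto simp: orthogonal_transformation_norm[OF f])
  then show ?thesis by (simp cong: measurable_cong_sets)
qed

text \<open>An orthogonal map commutes with \<open>sgn\<close> and preserves the punctured ball, so
  the cone over a preimage is the preimage of the cone.\<close>

lemma distr_sphere_measure_orthogonal:
  fixes f :: "'a::euclidean_space \<Rightarrow> 'a"
  assumes f: "orthogonal_transformation f"
  shows "distr sphere_measure sphere_measure f = sphere_measure"
proof (rule measure_eqI)
  fix A assume "A \<in> sets (distr sphere_measure sphere_measure f)"
  then have A: "A \<in> sets (restrict_space borel (sphere (0::'a) 1))" by simp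
  note fm = orthogonal_transformation_measurable_sphere[OF f]
  have fA: "f -` A \<inter> sphere 0 1 \<in> sets (restrict_space borel (sphere 0 1))"
    using measurable_sets[OF fm, of A] A by simp
  have "sgn -` (f -` A \<inter> sphere 0 1) \<inter> (cball 0 1 - {0}) = f -` (sgn -` A \<inter> (cball 0 1 - {0}))"
  proof -
    have "f (sgn y) = sgn (f y)" for y
      by (simp add: sgn_div_norm orthogonal_transformation_norm[OF f] orthogonal_transformation_scaleR[OF f])
    moreover have "f y = 0 \<longleftrightarrow> y = 0" for y
      by (metis orthogonal_transformation_norm[OF f] norm_eq_zero)
    ultimately show ?thesis
      by (auto simp: orthogonal_transformation_norm[OF f] norm_sgn)
  qed
  moreover have "sgn -` A \<inter> (cball 0 1 - {0}) \<in> sets borel"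
    using measurable_sets[OF sgn_measurable_sphere A] 
    by (simp add: space_restrict_space sets_restrict_space_iff)
  ultimately have "emeasure lborel (sgn -` (f -` A \<inter> sphere 0 1) \<inter> (cball 0 1 - {0})) = emeasure lborel (sgn -` A \<inter> (cball 0 1 - {0}))"
    by (simp only: emeasure_lborel_vimage_orthogonal[OF f])
  then show "emeasure (distr sphere_measure sphere_measure f) A = emeasure sphere_measure A"
    using A by (simp add: emeasure_distr[OF fm] emeasure_sphere_measure[OF fA] emeasure_sphere_measure[OF A] del: vimage_Int)
qed simp

subsection \<open>Moments and the probability integral transform\<close>

text \<open>For variables bounded by 1 all absolute moments are at most 1, so the Taylor sums of the
  characteristic function converge at every \<open>t\<close>, and the moments determine the
  law.\<close>

lemma (in prob_space) distr_eqI_moments: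
  fixes U V :: "'a \<Rightarrow> real"
  assumes [measurable]: "U \<in> borel_measurable M" "V \<in> borel_measurable M"
    and U: "\<And>\<omega>. \<bar>U \<omega>\<bar> \<le> 1" and V: "\<And>\<omega>. \<bar>V \<omega>\<bar> \<le> 1"
    and moments: "\<And>k. expectation (\<lambda>\<omega>. U \<omega> ^ k) = expectation (\<lambda>\<omega>. V \<omega> ^ k)"
  shows "distr M borel U = distr M borel V"
proof (rule Levy_uniqueness)
  show "real_distribution (distr M borel U)" "real_distribution (distr M borel V)"
    by (rule real_distribution_distr, simp)+
  have approx: "cmod (char (distr M borel W) t - (\<Sum>k\<le>n. ((\<i> * t) ^ k / fact k) * expectation (\<lambda>\<omega>. W \<omega> ^ k)))
      \<le> 2 * (inverse (fact n) * \<bar>t\<bar> ^ n)"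
    if [measurable]: "W \<in> borel_measurable M" and W: "\<And>\<omega>. \<bar>W \<omega>\<bar> \<le> 1" for W n t
  proof -
    have pow: "\<bar>W \<omega>\<bar> ^ k \<le> 1" for \<omega> k by (rule power_le_one) (use W in auto)
    have int: "integrable M (\<lambda>\<omega>. W \<omega> ^ k)" for k
      by (rule integrable_const_bound[where B = 1]) (auto simp: power_abs pow)
    have "expectation (\<lambda>\<omega>. \<bar>W \<omega>\<bar> ^ n) \<le> expectation (\<lambda>\<omega>. 1)"
      using integrable_abs[OF int[of n]] by (intro integral_mono) (auto simp: power_abs pow)
    then have "(2 * \<bar>t\<bar> ^ n / fact n) * expectation (\<lambda>\<omega>. \<bar>W \<omega>\<bar> ^ n) \<le> (2 * \<bar>t\<bar> ^ n / fact n) * 1"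
      by (intro mult_left_mono) (auto simp: prob_space)
    with char_approx1'[OF int that(1) refl, where n = n and t = t] show ?thesis
      by (simp add: field_simps)
  qed
  show "char (distr M borel U) = char (distr M borel V)"
  proof (rule ext)
    fix t
    \<comment> \<open>Equal moments make the two Taylor sums identical; only the two remainders are
      left.\<close>
    have "cmod (char (distr M borel U) t - char (distr M borel V) t) \<le> 4 * (inverse (fact n) * \<bar>t\<bar> ^ n)" for n
      using norm_triangle_ineq4[of "char (distr M borel U) t - (\<Sum>k\<le>n. ((\<i> * t) ^ k / fact k) * expectation (\<lambda>\<omega>. U \<omega> ^ k))"
          "char (distr M borel V) t - (\<Sum>k\<le>n. ((\<i> * t) ^ k / fact k) * expectation (\<lambda>\<omega>. V \<omega> ^ k))"]
        approx[OF assms(1) U, of t n] approx[OF assms(2) V, of t n]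
      by (simp add: moments)
    moreover have "(\<lambda>n. 4 * (inverse (fact n) * \<bar>t\<bar> ^ n)) \<longlonglongrightarrow> 4 * 0"
      by (intro tendsto_mult_left summable_LIMSEQ_zero summable_exp)
    ultimately have "cmod (char (distr M borel U) t - char (distr M borel V) t) \<le> 0"
      by (intro LIMSEQ_le_const[where X = "\<lambda>n. 4 * (inverse (fact n) * \<bar>t\<bar> ^ n)"]) auto
    then show "char (distr M borel U) t = char (distr M borel V) t" by simp
  qed
qed

section \<open>Tail transform and the uniform law\<close>

lemma (in real_distribution) measure_greaterThan_eq_cdf: "measure M {x<..} = 1 - cdf M x"
  using prob_compl[of "{..x}"] by (simp add: cdf_def Compl_eq_Diff_UNIV[symmetric])

lemma (in real_distribution) sets_tail_le: "{x. measure M {x<..} \<le> u} \<in> sets borel"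
proof -
  have "mono (cdf M)" by (auto simp: mono_def cdf_nondecreasing)
  then have [measurable]: "cdf M \<in> borel_measurable borel" by (rule borel_measurable_mono)
  show ?thesis unfolding measure_greaterThan_eq_cdf by simp
qed

text \<open>Without atoms the tail function is continuous and takes every value in (0,1). The set in
  question is then squeezed between half-lines of measure \<open>u\<close> and of measure
  \<open>v\<close>, with \<open>v\<close> decreasing to \<open>u\<close>.\<close>

lemma (in real_distribution) probability_integral_transform:
  assumes atomless: "\<And>x. measure M {x} = 0" and u: "0 < u" "u < 1"
  shows "measure M {x. measure M {x<..} \<le> u} = u"
proof -
  note tail = measure_greaterThan_eq_cdf
  have quantile: "\<exists>x. measure M {x<..} = v" if v: "0 < v" "v < 1" for v
  proof -
    have "\<forall>\<^sub>F x in at_bot. cdf M x < 1 - v"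
      by (rule order_tendstoD(2)[OF cdf_lim_at_bot]) (use v in auto)
    then obtain a where a: "cdf M a < 1 - v" by (auto simp: eventually_at_bot_linorder)
    have "\<forall>\<^sub>F x in at_top. 1 - v < cdf M x"
      by (rule order_tendstoD(1)[OF cdf_lim_at_top_prob]) (use v in auto)
    then obtain b where b: "1 - v < cdf M b" by (auto simp: eventually_at_top_linorder)
    have "a \<le> b" using a b cdf_nondecreasing[of b a] by linarith
    then have "\<exists>x\<ge>a. x \<le> b \<and> cdf M x = 1 - v"
      using a b by (intro IVT) (auto simp: isCont_cdf atomless)
    then obtain x where "cdf M x = 1 - v" by blast
    then have "measure M {x<..} = v" by (simp add: tail)
    then show ?thesis ..
  qed
  have meas: "{x. measure M {x<..} \<le> u} \<in> sets M"
    using sets_tail_le by simp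
  obtain a where a: "measure M {a<..} = u" using quantile u by blast
  have "{a<..} \<subseteq> {x. measure M {x<..} \<le> u}"
    using a by (auto simp: tail cdf_nondecreasing)
  from finite_measure_mono[OF this meas] have lower: "u \<le> measure M {x. measure M {x<..} \<le> u}"
    by (simp add: a)
  \<comment> \<open>The tail may be constant on an interval, so the set can exceed
    \<open>{a<..}\<close>; a half-line with strictly larger tail \<open>v\<close> still contains
    it.\<close>
  have "measure M {x. measure M {x<..} \<le> u} \<le> v" if v: "u < v" "v < 1" for v
  proof -
    obtain b where b: "measure M {b<..} = v" using quantile[of v] u v by auto
    have "{x. measure M {x<..} \<le> u} \<subseteq> {b<..}"
    proof (clarsimp, rule ccontr)
      fix x assume "measure M {x<..} \<le> u" "\<not> b < x"
      then show False using b v cdf_nondecreasing[of x b] by (auto simp: tail)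
    qed
    from finite_measure_mono[OF this] b show ?thesis by simp
  qed
  then have "measure M {x. measure M {x<..} \<le> u} \<le> u"
    by (rule dense_ge_bounded[OF u(2)])
  with lower show ?thesis by simp
qed

text \<open>Monotonicity forces the distribution function outside (0,1): it lies below every
  positive \<open>v\<close> for \<open>u \<le> 0\<close> and above every \<open>v < 1\<close> for
  \<open>u \<ge> 1\<close>.\<close>

lemma (in prob_space) distr_eq_uniform_01I:
  assumes [measurable]: "U \<in> borel_measurable M"
    and cdf_U: "\<And>u. 0 < u \<Longrightarrow> u < 1 \<Longrightarrow> measure M {\<omega>\<in>space M. U \<omega> \<le> u} = u"
  shows "distr M lborel U = uniform_measure lborel {0<..<1::real}"
proof (rule cdf_unique)
  have "real_distribution (distr M borel U)" by simp
  then show rd: "real_distribution (distr M lborel U)"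
    by (simp cong: distr_cong)
  show "real_distribution (uniform_measure lborel {0<..<1::real})"
    unfolding real_distribution_def real_distribution_axioms_def
    by (intro conjI prob_space_uniform_measure) auto
  have cdfU: "cdf (distr M lborel U) u = measure M {\<omega>\<in>space M. U \<omega> \<le> u}" for u
    unfolding cdf_def by (subst measure_distr) (auto intro!: arg_cong[where f = "measure M"])
  have unif: "cdf (uniform_measure lborel {0<..<1}) u = measure lborel ({0<..<1} \<inter> {..u})" for u :: real
    unfolding cdf_def by (subst measure_uniform_measure) auto
  show "cdf (distr M lborel U) = cdf (uniform_measure lborel {0<..<1})"
  proof (rule ext)
    fix u :: real
    have mono: "measure M {\<omega>\<in>space M. U \<omega> \<le> a} \<le> measure M {\<omega>\<in>space M. U \<omega> \<le> b}" if "a \<le> b" for a b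
      using that by (intro finite_measure_mono) auto
    consider "u \<le> 0" | "0 < u" "u < 1" | "1 \<le> u" by linarith
    then show "cdf (distr M lborel U) u = cdf (uniform_measure lborel {0<..<1}) u"
    proof cases
      case 1
      have "measure M {\<omega>\<in>space M. U \<omega> \<le> u} \<le> v" if "0 < v" "v < 1" for v
        using mono[of u v] cdf_U[OF that] 1 that by auto
      then have "measure M {\<omega>\<in>space M. U \<omega> \<le> u} \<le> 0"
        by (intro dense_ge_bounded[of 0 1]) auto
      moreover have "{0<..<1} \<inter> {..u} = {}" using 1 by auto
      ultimately show ?thesis by (simp add: cdfU unif measure_le_0_iff)
    next
      case 2
      then have "{0<..<1} \<inter> {..u} = {0<..u}" by auto
      with 2 show ?thesis by (simp add: cdfU unif cdf_U)
    next
      case 3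
      have "v \<le> measure M {\<omega>\<in>space M. U \<omega> \<le> u}" if "0 < v" "v < 1" for v
        using mono[of v u] cdf_U[OF that] 3 that by auto
      then have "1 \<le> measure M {\<omega>\<in>space M. U \<omega> \<le> u}"
        by (intro dense_le_bounded[of 0 1]) auto
      moreover have "{0<..<1} \<inter> {..u} = {0<..<1}" using 3 by auto
      ultimately show ?thesis by (simp add: cdfU unif antisym)
    qed
  qed
qed

section \<open>Share of points above a random level\<close>

text \<open>\<open>S\<close> is to be the normalised surface measure. Geometry and Gaussianity enter
  only through the hypotheses \<open>orthant\<close>, \<open>no_ties\<close> and \<open>same\<close>
  of the lemmas below.\<close>

locale occupation = S: prob_space S + M: prob_space M
  for S :: "'t measure" and M :: "'w measure" +
  fixes X :: "'t \<Rightarrow> 'w \<Rightarrow> real"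
  assumes joint: "(\<lambda>(t, \<omega>). X t \<omega>) \<in> borel_measurable (S \<Otimes>\<^sub>M M)"
begin

lemma X_measurable [measurable (raw)]:
  "f \<in> N \<rightarrow>\<^sub>M S \<Longrightarrow> g \<in> N \<rightarrow>\<^sub>M M \<Longrightarrow> (\<lambda>z. X (f z) (g z)) \<in> borel_measurable N"
  using measurable_compose[OF measurable_Pair joint] by simp

text \<open>The share \<open>U\<close> at \<open>t\<close> of the overview, written as an integral
  of an indicator so that its powers become integrals of orthant indicators.\<close>

definition above :: "'t \<Rightarrow> 'w \<Rightarrow> real" where
  "above t \<omega> = (LINT s|S. indicator {0<..} (X s \<omega> - X t \<omega>))"

lemma above_measurable [measurable (raw)]:
  assumes [measurable]: "f \<in> N \<rightarrow>\<^sub>M S" "g \<in> N \<rightarrow>\<^sub>M M"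
  shows "(\<lambda>z. above (f z) (g z)) \<in> borel_measurable N"
  unfolding above_def by measurable

lemma above_eq_measure:
  assumes "\<omega> \<in> space M"
  shows "above t \<omega> = measure S {s\<in>space S. X t \<omega> < X s \<omega>}"
proof -
  have "above t \<omega> = (LINT s|S. indicator {s\<in>space S. X t \<omega> < X s \<omega>} s)"
    unfolding above_def by (rule Bochner_Integration.integral_cong) (auto simp: indicator_def)
  also have "\<dots> = measure S ({s\<in>space S. X t \<omega> < X s \<omega>} \<inter> space S)"
    by simp
  also have "{s\<in>space S. X t \<omega> < X s \<omega>} \<inter> space S = {s\<in>space S. X t \<omega> < X s \<omega>}" by auto
  finally show ?thesis .
qed

lemma above_bounds: "0 \<le> above t \<omega>" "above t \<omega> \<le> 1"
proof -
  show "0 \<le> above t \<omega>" unfolding above_def by simp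
  show "above t \<omega> \<le> 1"
  \<comment> \<open>For \<omega> outside \<open>space M\<close> integrability is not guaranteed; the
    integral then has the default value 0.\<close>
  proof (cases "integrable S (\<lambda>s. indicator {0<..} (X s \<omega> - X t \<omega>) :: real)")
    case True
    then have "above t \<omega> \<le> (LINT s|S. 1)"
      unfolding above_def by (intro integral_mono) (auto simp: indicator_def)
    then show ?thesis by (simp add: S.prob_space)
  next
    case False
    then show ?thesis by (simp add: above_def not_integrable_integral_eq)
  qed
qed

lemma orthant_measurable:
  assumes t: "t \<in> space S"
  shows "(\<lambda>(s, \<omega>). \<Prod>i<k. indicator {0<..} (X (s i) \<omega> - X t \<omega>) :: real) \<in> borel_measurable (PiM {..<k} (\<lambda>_. S) \<Otimes>\<^sub>M M)"
  unfolding split_beta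
proof (rule borel_measurable_prod)
  note [measurable] = measurable_const[OF t]
  fix i assume "i \<in> {..<k}"
  then have [measurable]: "(\<lambda>x. fst x i) \<in> PiM {..<k} (\<lambda>_. S) \<Otimes>\<^sub>M M \<rightarrow>\<^sub>M S"
    by (intro measurable_compose[OF measurable_fst measurable_component_singleton])
  show "(\<lambda>x. indicator {0<..} (X (fst x i) (snd x) - X t (snd x)) :: real) \<in> borel_measurable (PiM {..<k} (\<lambda>_. S) \<Otimes>\<^sub>M M)"
    by measurable
qed

text \<open>For a fixed path, the \<open>k\<close>-th power is the probability that \<open>k\<close>
  independent points all lie above the level of \<open>t\<close>; Fubini then exchanges points and
  paths.\<close>

lemma above_moment:
  assumes t: "t \<in> space S"
  shows "M.expectation (\<lambda>\<omega>. above t \<omega> ^ k)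
    = (LINT s|PiM {..<k} (\<lambda>_. S). M.expectation (\<lambda>\<omega>. \<Prod>i<k. indicator {0<..} (X (s i) \<omega> - X t \<omega>)))"
proof -
  let ?P = "PiM {..<k} (\<lambda>_. S)"
  interpret product_sigma_finite "\<lambda>_::nat. S" ..
  interpret P: prob_space ?P by (rule prob_space_PiM) (rule S.prob_space_axioms)
  interpret PM: pair_prob_space ?P M ..
  note [measurable] = measurable_const[OF t]
  have "M.expectation (\<lambda>\<omega>. above t \<omega> ^ k)
     = M.expectation (\<lambda>\<omega>. LINT s|?P. (\<Prod>i<k. indicator {0<..} (X (s i) \<omega> - X t \<omega>)))"
  proof (rule Bochner_Integration.integral_cong[OF refl])
    fix \<omega> assume \<omega>: "\<omega> \<in> space M"
    note [measurable] = measurable_const[OF \<omega>]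
    have "(LINT s|?P. (\<Prod>i<k. indicator {0<..} (X (s i) \<omega> - X t \<omega>))) = (\<Prod>i<k. above t \<omega>)"
      unfolding above_def
      by (rule product_integral_prod) (auto intro!: S.integrable_const_bound[where B = 1] simp: indicator_def)
    then show "above t \<omega> ^ k = (LINT s|?P. (\<Prod>i<k. indicator {0<..} (X (s i) \<omega> - X t \<omega>)))" by simp
  qed
  also have "\<dots> = (LINT s|?P. M.expectation (\<lambda>\<omega>. \<Prod>i<k. indicator {0<..} (X (s i) \<omega> - X t \<omega>)))"
  proof (rule PM.Fubini_integral)
    show "integrable (?P \<Otimes>\<^sub>M M) (\<lambda>(s, \<omega>). \<Prod>i<k. indicator {0<..} (X (s i) \<omega> - X t \<omega>) :: real)"
      by (rule PM.integrable_const_bound[where B = 1])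
        (auto simp: orthant_measurable[OF t] abs_prod split_beta simp del: measurable_split_conv intro!: prod_le_1)
  qed
  finally show ?thesis .
qed

text \<open>\<open>R\<close> stands for a rotation taking \<open>p\<close> to \<open>t\<close>. The
  moment integrand for \<open>p\<close> at \<open>s\<close> is that for \<open>t\<close> at the
  rotated points, and invariance of \<open>S\<close> removes the rotation, so all moments
  agree.\<close>

lemma above_distr_eqI:
  assumes p: "p \<in> space S" and t: "t \<in> space S"
    and R[measurable]: "R \<in> S \<rightarrow>\<^sub>M S" and inv: "distr S S R = S"
    and orthant: "\<And>(k::nat) (s::nat \<Rightarrow> 't). (\<And>i. i < k \<Longrightarrow> s i \<in> space S) \<Longrightarrow>
      M.expectation (\<lambda>\<omega>. \<Prod>i<k. indicator {0<..} (X (s i) \<omega> - X p \<omega>))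
      = (M.expectation (\<lambda>\<omega>. \<Prod>i<k. indicator {0<..} (X (R (s i)) \<omega> - X t \<omega>)) :: real)"
  shows "distr M borel (above p) = distr M borel (above t)"
proof (rule M.distr_eqI_moments)
  note [measurable] = measurable_const[OF p] measurable_const[OF t]
  show "above p \<in> borel_measurable M" "above t \<in> borel_measurable M" by measurable
  show "\<bar>above p \<omega>\<bar> \<le> 1" "\<bar>above t \<omega>\<bar> \<le> 1" for \<omega>
    using above_bounds by auto
  fix k :: nat
  let ?P = "PiM {..<k} (\<lambda>_. S)"
  let ?h = "\<lambda>s. M.expectation (\<lambda>\<omega>. \<Prod>i<k. indicator {0<..} (X (s i) \<omega> - X t \<omega>)) :: real"
  have hm: "?h \<in> borel_measurable ?P"
    by (rule M.borel_measurable_lebesgue_integral[OF orthant_measurable[OF t]])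
  \<comment> \<open>\<open>compose\<close> applies \<open>R\<close> coordinatewise and remains
    undefined off \<open>{..<k}\<close>, as points of the product space must.\<close>
  have "M.expectation (\<lambda>\<omega>. above p \<omega> ^ k) = (LINT s|?P. ?h (compose {..<k} R s))"
    unfolding above_moment[OF p]
  proof (rule Bochner_Integration.integral_cong[OF refl])
    fix s assume "s \<in> space ?P"
    then have "s i \<in> space S" if "i < k" for i using that by (auto simp: space_PiM PiE_def)
    from orthant[of k s, OF this] show "M.expectation (\<lambda>\<omega>. \<Prod>i<k. indicator {0<..} (X (s i) \<omega> - X p \<omega>)) = ?h (compose {..<k} R s)"
      by (simp add: compose_def)
  qed
  also have "\<dots> = (LINT s|distr ?P ?P (compose {..<k} R). ?h s)"
  proof (rule integral_distr[symmetric, OF _ hm])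
    show "compose {..<k} R \<in> ?P \<rightarrow>\<^sub>M ?P"
      unfolding compose_def by measurable
  qed
  also have "distr ?P ?P (compose {..<k} R) = ?P"
    by (subst distr_PiM_finite_prob_space') (auto simp: inv S.prob_space_axioms)
  also have "(LINT s|?P. ?h s) = M.expectation (\<lambda>\<omega>. above t \<omega> ^ k)"
    by (rule above_moment[OF t, symmetric])
  finally show "M.expectation (\<lambda>\<omega>. above p \<omega> ^ k) = M.expectation (\<lambda>\<omega>. above t \<omega> ^ k)" .
qed

text \<open>By Fubini almost every path has no ties at almost every point, so its occupation law has
  no atoms. The share above is the tail of this law at the path's own value, hence uniform.\<close>

lemma above_path_uniform:
  assumes no_ties: "\<And>s. s \<in> space S \<Longrightarrow> AE t in S. AE \<omega> in M. X s \<omega> \<noteq> X t \<omega>"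
  shows "AE \<omega> in M. \<forall>u. 0 < u \<longrightarrow> u < 1 \<longrightarrow> measure S {t\<in>space S. above t \<omega> \<le> u} = u"
proof -
  interpret SM: pair_prob_space S M ..
  \<comment> \<open>a jointly measurable surrogate for \<open>AE t in S. X s \<omega> \<noteq> X t \<omega>\<close>, so that the
    quantifiers over \<open>s\<close> and \<open>\<omega>\<close> can be exchanged\<close>
  define ties where "ties s \<omega> = (\<integral>\<^sup>+t. indicator {0} (X s \<omega> - X t \<omega>) \<partial>S)" for s \<omega>
  have [measurable]: "(\<lambda>z. ties (fst z) (snd z)) \<in> borel_measurable (S \<Otimes>\<^sub>M M)"
    unfolding ties_def by measurable
  have "AE \<omega> in M. ties s \<omega> = 0" if s: "s \<in> space S" for s
  proof -
    note [measurable] = measurable_const[OF s]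
    have "AE \<omega> in M. AE t in S. X s \<omega> \<noteq> X t \<omega>"
      using no_ties[OF s] by (subst SM.AE_commute[symmetric]) measurable
    moreover have "ties s \<omega> = 0" if "\<omega> \<in> space M" "AE t in S. X s \<omega> \<noteq> X t \<omega>" for \<omega>
    proof -
      note [measurable] = measurable_const[OF that(1)]
      show ?thesis unfolding ties_def
        using that(2) by (subst nn_integral_0_iff_AE) (auto elim!: eventually_mono)
    qed
    ultimately show ?thesis by auto
  qed
  then have "AE s in S. AE \<omega> in M. ties s \<omega> = 0" by auto
  then have "AE \<omega> in M. AE s in S. ties s \<omega> = 0"
    by (subst SM.AE_commute[symmetric]) measurable
  then show ?thesis
  proof (rule AE_mp, intro AE_I2 impI allI)
    fix \<omega> u assume \<omega>: "\<omega> \<in> space M" and ae: "AE s in S. ties s \<omega> = 0" and u: "0 < u" "u < (1::real)"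
    note [measurable] = measurable_const[OF \<omega>]
    have [measurable]: "(\<lambda>s. X s \<omega>) \<in> borel_measurable S" by measurable
    define \<nu> where "\<nu> = distr S borel (\<lambda>s. X s \<omega>)"
    interpret \<nu>: real_distribution \<nu>
      unfolding \<nu>_def by (rule S.real_distribution_distr) measurable
    have \<nu>: "measure \<nu> A = measure S {s\<in>space S. X s \<omega> \<in> A}" if "A \<in> sets borel" for A
      unfolding \<nu>_def using that by (subst measure_distr) (auto intro!: arg_cong[where f = "measure S"])
    have atomless: "measure \<nu> {x} = 0" for x
    proof (rule ccontr)
      assume "measure \<nu> {x} \<noteq> 0"
      then have "measure S {s\<in>space S. X s \<omega> = x} \<noteq> 0"
        by (simp add: \<nu>)
      then have pos: "emeasure S {s\<in>space S. X s \<omega> = x} \<noteq> 0"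
        by (auto simp: measure_def)
      \<comment> \<open>The level set of an atom has positive mass while almost every
        \<open>s\<close> has no ties, so some \<open>s\<close> satisfies both; its tie mass is then
        the mass of the atom.\<close>
      have "\<exists>s\<in>space S. X s \<omega> = x \<and> ties s \<omega> = 0"
      proof (rule ccontr)
        assume none: "\<not> ?thesis"
        have "AE s in S. X s \<omega> \<noteq> x"
          by (rule AE_mp[OF ae], rule AE_I2) (use none in auto)
        then have "emeasure S {s\<in>space S. X s \<omega> = x} = 0"
          by (subst (asm) AE_iff_measurable[OF _ refl]) auto
        with pos show False ..
      qed
      then obtain s where "X s \<omega> = x" and z: "ties s \<omega> = 0" by blast
      then have "ties s \<omega> = (\<integral>\<^sup>+t. indicator {s\<in>space S. X s \<omega> = x} t \<partial>S)"
        unfolding ties_def by (intro nn_integral_cong) (auto simp: indicator_def)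
      then have "ties s \<omega> = emeasure S {s\<in>space S. X s \<omega> = x}" by simp
      with z pos show False by simp
    qed
    \<comment> \<open>\<open>above t \<omega>\<close> is the \<nu>-tail at
      \<open>X t \<omega>\<close>.\<close>
    have "{t\<in>space S. above t \<omega> \<le> u} = {t\<in>space S. X t \<omega> \<in> {x. measure \<nu> {x<..} \<le> u}}"
      by (auto simp: above_eq_measure[OF \<omega>] \<nu>)
    then show "measure S {t\<in>space S. above t \<omega> \<le> u} = u"
      using \<nu>.probability_integral_transform[OF atomless u] \<nu>[OF \<nu>.sets_tail_le] by simp
  qed
qed

text \<open>The laws for all \<open>t\<close> agree, so the probability for \<open>p\<close> equals
  its average over \<open>t\<close>. Fubini turns this average into the expected share of
  \<open>t\<close> with \<open>above t \<omega> \<le> u\<close>, which is almost surely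
  \<open>u\<close>.\<close>

lemma above_distr_uniform:
  assumes p: "p \<in> space S"
    and no_ties: "\<And>s. s \<in> space S \<Longrightarrow> AE t in S. AE \<omega> in M. X s \<omega> \<noteq> X t \<omega>"
    and same: "\<And>t. t \<in> space S \<Longrightarrow> distr M borel (above p) = distr M borel (above t)"
  shows "distr M lborel (above p) = uniform_measure lborel {0<..<1::real}"
proof (rule M.distr_eq_uniform_01I)
  interpret SM: pair_prob_space S M ..
  have path_uniform: "AE \<omega> in M. \<forall>u. 0 < u \<longrightarrow> u < 1 \<longrightarrow> measure S {t\<in>space S. above t \<omega> \<le> u} = u"
    by (rule above_path_uniform) (rule no_ties)
  show "above p \<in> borel_measurable M"
    using measurable_const[OF p] by measurable
  fix u :: real assume u: "0 < u" "u < 1"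
  have law: "measure (distr M borel (above t)) {..u} = M.expectation (\<lambda>\<omega>. indicator {..u} (above t \<omega>))"
    "measure (distr M borel (above t)) {..u} = measure M {\<omega>\<in>space M. above t \<omega> \<le> u}"
    if t: "t \<in> space S" for t
  proof -
    note [measurable] = measurable_const[OF t]
    show "measure (distr M borel (above t)) {..u} = measure M {\<omega>\<in>space M. above t \<omega> \<le> u}"
      by (subst measure_distr) (auto intro!: arg_cong[where f = "measure M"])
    also have "\<dots> = M.expectation (\<lambda>\<omega>. indicator {\<omega>\<in>space M. above t \<omega> \<le> u} \<omega>)"
      by (simp add: Int_absorb2)
    also have "\<dots> = M.expectation (\<lambda>\<omega>. indicator {..u} (above t \<omega>))"
      by (rule Bochner_Integration.integral_cong) (auto simp: indicator_def)
    finally show "measure (distr M borel (above t)) {..u} = M.expectation (\<lambda>\<omega>. indicator {..u} (above t \<omega>))" .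
  qed
  have "measure M {\<omega>\<in>space M. above p \<omega> \<le> u} = (LINT t|S. measure M {\<omega>\<in>space M. above p \<omega> \<le> u})"
    by (simp add: S.prob_space)
  also have "\<dots> = (LINT t|S. M.expectation (\<lambda>\<omega>. indicator {..u} (above t \<omega>)))"
    by (rule Bochner_Integration.integral_cong[OF refl])
      (simp only: law(2)[OF p, symmetric] same law(1))
  also have "\<dots> = M.expectation (\<lambda>\<omega>. LINT t|S. indicator {..u} (above t \<omega>))"
    by (rule SM.Fubini_integral[symmetric], unfold split_beta, rule SM.integrable_const_bound[where B = 1])
      (auto simp: indicator_def)
  also have "\<dots> = M.expectation (\<lambda>\<omega>. u)"
  proof (rule integral_cong_AE)
    show "AE \<omega> in M. (LINT t|S. indicator {..u} (above t \<omega>)) = u"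
    proof (rule AE_mp[OF path_uniform], intro AE_I2 impI)
      fix \<omega> assume "\<omega> \<in> space M" and unif: "\<forall>u. 0 < u \<longrightarrow> u < 1 \<longrightarrow> measure S {t\<in>space S. above t \<omega> \<le> u} = u"
      have "(LINT t|S. indicator {..u} (above t \<omega>)) = (LINT t|S. indicator {t\<in>space S. above t \<omega> \<le> u} t)"
        by (rule Bochner_Integration.integral_cong) (auto simp: indicator_def)
      also have "\<dots> = measure S {t\<in>space S. above t \<omega> \<le> u}"
        by (simp add: Int_absorb2)
      finally show "(LINT t|S. indicator {..u} (above t \<omega>)) = u"
        using unif u by simp
    qed
  qed measurable
  finally show "measure M {\<omega>\<in>space M. above p \<omega> \<le> u} = u"
    by (simp add: M.prob_space)
qed

end

subsection \<open>Spherical fractional Brownian motion\<close>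

theorem mainTheorem4:
  fixes M :: "'w measure" and H :: real and X :: "real ^ 'n \<Rightarrow> 'w \<Rightarrow> real"
  assumes "prob_space M"
    and "CARD('n) \<ge> 2"
    and "0 < H" and "H \<le> 1/2"
    and "spherical_fBm M H X"
    and "(\<lambda>(t, \<omega>). X t \<omega>) \<in> borel_measurable (restrict_space borel (sphere 0 1) \<Otimes>\<^sub>M M)"
  shows "measure sphere_measure (sphere (0 :: real ^ 'n) 1)
           = 2 * pi powr (CARD('n) / 2) / Gamma (CARD('n) / 2)
       \<and> distr M lborel
           (\<lambda>\<omega>. (integral\<^sup>L sphere_measure (\<lambda>s. indicator {s. X s \<omega> > 0} s))
                 / measure sphere_measure (sphere (0 :: real ^ 'n) 1))
         = uniform_measure lborel {0<..<1::real}"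
proof
  let ?\<sigma> = "sphere_measure :: (real ^ 'n) measure"
  define m where "m = measure ?\<sigma> (sphere 0 1)"
  \<comment> \<open>Normalised to mass 1, so that it can serve as the law of a random point.\<close>
  define S where "S = scale_measure (ennreal (1 / m)) ?\<sigma>"
  interpret sig: finite_measure ?\<sigma> by (rule finite_measure_sphere_measure)
  show "measure ?\<sigma> (sphere 0 1) = 2 * pi powr (CARD('n) / 2) / Gamma (CARD('n) / 2)"
    using measure_sphere_measure_sphere[where 'a = "real ^ 'n"] by simp
  then have m: "0 < m"
    by (simp add: m_def)
  have space_S: "space S = sphere 0 1" and sets_S: "sets S = sets ?\<sigma>"
    by (simp_all add: S_def space_scale_measure)
  have emeasure_S: "emeasure S A = ennreal (1 / m) * emeasure ?\<sigma> A" for A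
    by (simp add: S_def)
  have "emeasure S (space S) = ennreal (1 / m) * ennreal m"
    by (simp add: emeasure_S space_S m_def sig.emeasure_eq_measure)
  also have "\<dots> = 1"
    using m by (simp flip: ennreal_mult)
  finally have "prob_space S" by (rule prob_spaceI)
  interpret M: prob_space M by fact
  interpret occupation S M X
  proof (intro occupation.intro occupation_axioms.intro)
    have "sets (S \<Otimes>\<^sub>M M) = sets (restrict_space borel (sphere 0 1) \<Otimes>\<^sub>M M)"
      by (rule sets_pair_measure_cong) (simp_all add: sets_S)
    then show "(\<lambda>(t, \<omega>). X t \<omega>) \<in> borel_measurable (S \<Otimes>\<^sub>M M)"
      using assms(6) by (simp cong: measurable_cong_sets)
  qed fact+
  have X: "centred_gaussian_process M (sphere 0 1) X"
    and incr: "\<And>s t. s \<in> sphere 0 1 \<Longrightarrow> t \<in> sphere 0 1 \<Longrightarrow>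
      M.expectation (\<lambda>\<omega>. (X s \<omega> - X t \<omega>)\<^sup>2) = geodesic_dist s t powr (2 * H)"
    using assms(5) by (auto simp: spherical_fBm_def)
  obtain p where p: "p \<in> sphere 0 1" and Xp: "AE \<omega> in M. X p \<omega> = 0"
    using assms(5) by (auto simp: spherical_fBm_def)
  have pS: "p \<in> space S" using p by (simp add: space_S)

  \<comment> \<open>Distinct unit vectors have inner product below 1, hence positive distance and
    positive increment variance, so the Gaussian increment is almost surely nonzero. The excluded
    point \<open>s\<close> is null since the dimension is at least 2.\<close>
  have no_ties: "AE t in S. AE \<omega> in M. X s \<omega> \<noteq> X t \<omega>" if s: "s \<in> space S" for s
  proof -
    have "emeasure S {s} = 0"
      using emeasure_sphere_measure_singleton[of s] assms(2) s by (simp add: emeasure_S space_S)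
    moreover have "{s} \<in> sets S"
      unfolding sets_S sets_sphere_measure sets_restrict_space
      by (rule image_eqI[where x = "{s}"]) (use s in \<open>auto simp: space_S\<close>)
    ultimately have off_s: "AE t in S. t \<noteq> s"
      by (intro AE_I[where N = "{s}"]) auto
    show ?thesis
    proof (rule AE_mp[OF off_s AE_I2[OF impI]])
      fix t assume t: "t \<in> space S" "t \<noteq> s"
      then have norms: "norm s = 1" "norm t = 1" using s by (auto simp: space_S)
      have "s \<bullet> t \<noteq> 1"
      proof
        assume "s \<bullet> t = 1"
        then have "s = t"
          using norms by (simp add: vector_eq[of s t] dot_square_norm)
        then show False using t by simp
      qed
      moreover have "\<bar>s \<bullet> t\<bar> \<le> 1"
        using Cauchy_Schwarz_ineq2[of s t] norms by simp
      ultimately have "geodesic_dist s t \<noteq> 0"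
        unfolding geodesic_dist_def using arccos_eq_0_iff[of "s \<bullet> t"] by (auto simp: abs_le_iff)
      then have "M.expectation (\<lambda>\<omega>. (X s \<omega> - X t \<omega>)\<^sup>2) \<noteq> 0"
        using s t by (simp add: incr space_S)
      moreover have "centred_gaussian_rv M (\<lambda>\<omega>. X s \<omega> - X t \<omega>)"
        using centred_gaussian_process_diff[OF X] s t by (simp add: space_S)
      ultimately have "AE \<omega> in M. X s \<omega> - X t \<omega> \<noteq> 0"
        using M.centred_gaussian_rv_nonzero[of "\<lambda>\<omega>. X s \<omega> - X t \<omega>"] by blast
      then show "AE \<omega> in M. X s \<omega> \<noteq> X t \<omega>" by simp
    qed
  qed

  \<comment> \<open>An orthogonal map taking \<open>p\<close> to \<open>t\<close> preserves inner
    products, hence geodesic distances and increment variances.\<close>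
  have same: "distr M borel (above p) = distr M borel (above t)" if t: "t \<in> space S" for t
  proof -
    have "norm p = norm t" using p t by (simp add: space_S)
    then obtain f where f: "orthogonal_transformation f" and fp: "f p = t"
      by (rule orthogonal_transformation_exists)
    have fm: "f \<in> S \<rightarrow>\<^sub>M S"
      using orthogonal_transformation_measurable_sphere[OF f] by (simp add: sets_S cong: measurable_cong_sets)
    have "distr S S f = S"
    proof (rule measure_eqI)
      fix A assume "A \<in> sets (distr S S f)"
      then have A: "A \<in> sets S" by simp
      have "emeasure ?\<sigma> A = emeasure (distr ?\<sigma> ?\<sigma> f) A"
        by (simp only: distr_sphere_measure_orthogonal[OF f])
      also have "\<dots> = emeasure ?\<sigma> (f -` A \<inter> space S)"
        using emeasure_distr[OF orthogonal_transformation_measurable_sphere[OF f]] A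
        by (simp only: sets_S space_S space_sphere_measure)
      finally show "emeasure (distr S S f) A = emeasure S A"
        unfolding emeasure_distr[OF fm A] emeasure_S by (rule arg_cong[OF sym])
    qed simp
    with pS t fm show ?thesis
    proof (rule above_distr_eqI)
      fix k :: nat and s assume s: "\<And>i. i < k \<Longrightarrow> s i \<in> space S"
      \<comment> \<open>Appends \<open>p\<close> as the reference entry \<open>k\<close>; using
        \<open>p\<close> for all later indices as well keeps every \<open>s' i\<close> on the
        sphere.\<close>
      define s' where "s' = (\<lambda>i. if i < k then s i else p)"
      have s': "s' i \<in> sphere 0 1" for i
        using s p by (auto simp: s'_def space_S)
      have "M.expectation (\<lambda>\<omega>. \<Prod>i<k. indicator {0<..} (X (s' i) \<omega> - X (s' k) \<omega>))
        = (M.expectation (\<lambda>\<omega>. \<Prod>i<k. indicator {0<..} (X (f (s' i)) \<omega> - X (f (s' k)) \<omega>)) :: real)"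
      proof (rule M.gaussian_increments_orthant_eq[OF X])
        show "s' ` {..k} \<subseteq> sphere 0 1" "(\<lambda>i. f (s' i)) ` {..k} \<subseteq> sphere 0 1"
          using s' by (auto simp: orthogonal_transformation_norm[OF f])
        show "M.expectation (\<lambda>\<omega>. (X (s' i) \<omega> - X (s' j) \<omega>)\<^sup>2) = M.expectation (\<lambda>\<omega>. (X (f (s' i)) \<omega> - X (f (s' j)) \<omega>)\<^sup>2)" for i j
          using s' f by (simp add: incr orthogonal_transformation_norm[OF f] geodesic_dist_def orthogonal_transformation_def)
      qed
      then show "M.expectation (\<lambda>\<omega>. \<Prod>i<k. indicator {0<..} (X (s i) \<omega> - X p \<omega>))
        = (M.expectation (\<lambda>\<omega>. \<Prod>i<k. indicator {0<..} (X (f (s i)) \<omega> - X t \<omega>)) :: real)"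
        by (simp add: s'_def fp)
    qed
  qed

  \<comment> \<open>Where \<open>X p\<close> vanishes, lying above the level of \<open>p\<close>
    means being positive.\<close>
  have above_p: "above p \<omega> = (LINT s|?\<sigma>. indicator {s. X s \<omega> > 0} s) / m"
    if "\<omega> \<in> space M" "X p \<omega> = 0" for \<omega>
  proof -
    have "above p \<omega> = measure S {s\<in>space S. X s \<omega> > 0}"
      using that by (simp add: above_eq_measure)
    also have "\<dots> = measure ?\<sigma> {s\<in>space S. X s \<omega> > 0} / m"
      using m by (simp add: measure_def emeasure_S enn2real_mult)
    also have "measure ?\<sigma> {s\<in>space S. X s \<omega> > 0} = (LINT s|?\<sigma>. indicator {s\<in>space S. X s \<omega> > 0} s)"
      by simp (rule arg_cong[where f = "measure ?\<sigma>"], auto simp: space_S)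
    also have "\<dots> = (LINT s|?\<sigma>. indicator {s. X s \<omega> > 0} s)"
      by (rule Bochner_Integration.integral_cong) (auto simp: space_S indicator_def)
    finally show ?thesis .
  qed
  have "(\<lambda>\<omega>. LINT s|?\<sigma>. indicator {s. X s \<omega> > 0} s :: real) \<in> borel_measurable M"
  proof (rule sig.borel_measurable_lebesgue_integral)
    have "(\<lambda>z. X (snd z) (fst z)) \<in> borel_measurable (M \<Otimes>\<^sub>M S)" by measurable
    moreover have "borel_measurable (M \<Otimes>\<^sub>M S) = (borel_measurable (M \<Otimes>\<^sub>M ?\<sigma>) :: (_ \<Rightarrow> real) set)"
      by (intro measurable_cong_sets sets_pair_measure_cong refl sets_S)
    ultimately have [measurable]: "(\<lambda>z. X (snd z) (fst z)) \<in> borel_measurable (M \<Otimes>\<^sub>M ?\<sigma>)"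
      by blast
    have "(\<lambda>z. indicator {0<..} (X (snd z) (fst z)) :: real) \<in> borel_measurable (M \<Otimes>\<^sub>M ?\<sigma>)" by measurable
    then show "(\<lambda>(\<omega>, s). indicator {s. X s \<omega> > 0} s :: real) \<in> borel_measurable (M \<Otimes>\<^sub>M ?\<sigma>)"
      by (simp add: split_beta indicator_def)
  qed
  \<comment> \<open>\<open>X p\<close> vanishes only almost surely, so the two variables agree up to
    a null set; equality of laws then needs both to be measurable.\<close>
  then have "distr M lborel (\<lambda>\<omega>. (LINT s|?\<sigma>. indicator {s. X s \<omega> > 0} s) / m) = distr M lborel (above p)"
  proof (intro distr_cong_AE refl)
    show "AE \<omega> in M. (LINT s|?\<sigma>. indicator {s. X s \<omega> > 0} s) / m = above p \<omega>"
      using Xp by (rule AE_mp, intro AE_I2 impI) (rule above_p[symmetric])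
    have "above p \<in> borel_measurable M"
      using measurable_const[OF pS] by measurable
    then show "above p \<in> M \<rightarrow>\<^sub>M lborel" by simp
  qed simp
  also have "\<dots> = uniform_measure lborel {0<..<1}"
    by (rule above_distr_uniform[OF pS no_ties same])
  finally show "distr M lborel
           (\<lambda>\<omega>. (integral\<^sup>L ?\<sigma> (\<lambda>s. indicator {s. X s \<omega> > 0} s)) / measure ?\<sigma> (sphere 0 1))
         = uniform_measure lborel {0<..<1::real}"
    by (simp only: m_def)
qed

end
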